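(* Let $G_1$ be an $r_1$-regular graph on $n_1$ vertices and $m_1$ edges, and $G_2$ an arbitrary graph on $n_2$ vertices. Then $$\phi(L(G_1 \odot G_2); x) = (x-2)^{m_1-n_1} \cdot \prod_{i=2}^{n_2} (x-1-\mu_i(G_2))^{n_1} \cdot \prod_{i=1}^{n_1} \left( x^3 - (3+r_1+n_2)x^2 + (2+r_1+\mu_i(G_1)+2n_2)x - \mu_i(G_1) \right).$$
   Context: All graphs are finite, simple and undirected. For a graph $G$, $A(G)$ is its adjacency matrix, $D(G)$ the diagonal matrix of vertex degrees, and $L(G)=D(G)-A(G)$ its Laplacian matrix; $\phi(M;x)=\det(xI-M)$. The Laplacian eigenvalues of a graph $G$ on $n$ vertices are $0=\mu_1(G)\le\mu_2(G)\le\dots\le\mu_n(G)$. The subdivision graph $\mathcal{S}(G)$ is obtained from $G$ by inserting a new vertex into every edge of $G$. The subdivision-vertex corona $G_1\odot G_2$ of two vertex-disjoint graphs is the graph obtained from $\mathcal{S}(G_1)$ and $|V(G_1)|$ copies of $G_2$, all vertex-disjoint, by joining the $i$th vertex of $V(G_1)$ to every vertex in the $i$th copy of $G_2$. *)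

theory Defs
  imports
    "Graph_Theory.Pair_Digraph"
    "Jordan_Normal_Form.Char_Poly"
    "HOL-Computational_Algebra.Polynomial_Factorial"
begin

text \<open>
  A finite simple undirected graph is a \<^locale>\<open>pair_graph\<close>: a finite, loop-free, symmetric
  digraph whose arcs are pairs. Every undirected edge \<open>{u, v}\<close> is represented by the two
  arcs \<open>(u, v)\<close> and \<open>(v, u)\<close>; the degree of a vertex is its \<^const>\<open>out_degree\<close>.
\<close>

definition uedges :: "'a pair_pre_digraph \<Rightarrow> 'a set set" where
  "uedges G = {{u, v} | u v. (u, v) \<in> parcs G}"

definition regular_graph :: "nat \<Rightarrow> 'a pair_pre_digraph \<Rightarrow> bool" where
  "regular_graph r G \<longleftrightarrow> pair_graph G \<and> (\<forall>v \<in> pverts G. out_degree (with_proj G) v = r)"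

text \<open>
  Matrices have natural-number indices, so the matrices of a graph depend on an enumeration of
  its vertices, given as a list.
\<close>

definition enumerates :: "'a list \<Rightarrow> 'a set \<Rightarrow> bool" where
  "enumerates vs V \<longleftrightarrow> distinct vs \<and> set vs = V"

definition adjacency_matrix :: "'a list \<Rightarrow> 'a pair_pre_digraph \<Rightarrow> real mat" where
  "adjacency_matrix vs G =
     mat (length vs) (length vs) (\<lambda>(i, j). if (vs ! i, vs ! j) \<in> parcs G then 1 else 0)"

definition degree_matrix :: "'a list \<Rightarrow> 'a pair_pre_digraph \<Rightarrow> real mat" where
  "degree_matrix vs G = mat_diag (length vs) (\<lambda>i. real (out_degree (with_proj G) (vs ! i)))"

definition laplacian_matrix :: "'a list \<Rightarrow> 'a pair_pre_digraph \<Rightarrow> real mat" where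
  "laplacian_matrix vs G = degree_matrix vs G - adjacency_matrix vs G"

text \<open>
  The eigenvalues are the roots of the characteristic polynomial, repeated according to
  multiplicity, in non-decreasing order. They are numbered from 1.
\<close>

definition laplacian_eigenvalue :: "'a list \<Rightarrow> 'a pair_pre_digraph \<Rightarrow> nat \<Rightarrow> real" where
  "laplacian_eigenvalue vs G i =
     sorted_list_of_multiset (proots (char_poly (laplacian_matrix vs G))) ! (i - 1)"

text \<open>The vertex inserted into the edge \<open>e\<close> is \<open>Inr e\<close>.\<close>

definition subdivision_graph :: "'a pair_pre_digraph \<Rightarrow> ('a + 'a set) pair_pre_digraph" where
  "subdivision_graph G =
     \<lparr> pverts = pverts G <+> uedges G,
       parcs = {(Inl v, Inr e) | v e. e \<in> uedges G \<and> v \<in> e}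
             \<union> {(Inr e, Inl v) | v e. e \<in> uedges G \<and> v \<in> e} \<rparr>"

text \<open>
  The pair \<open>(v, w)\<close> is the vertex \<open>w\<close> in the copy of \<open>H\<close> that belongs to the vertex \<open>v\<close> of \<open>G\<close>.
\<close>

definition subdivision_vertex_corona ::
    "'a pair_pre_digraph \<Rightarrow> 'b pair_pre_digraph \<Rightarrow> (('a + 'a set) + 'a \<times> 'b) pair_pre_digraph"
  where
  "subdivision_vertex_corona G H =
     \<lparr> pverts = pverts (subdivision_graph G) <+> (pverts G \<times> pverts H),
       parcs = {(Inl s, Inl t) | s t. (s, t) \<in> parcs (subdivision_graph G)}
             \<union> {(Inr (v, w), Inr (v, w')) | v w w'. v \<in> pverts G \<and> (w, w') \<in> parcs H}
             \<union> {(Inl (Inl v), Inr (v, w)) | v w. v \<in> pverts G \<and> w \<in> pverts H}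
             \<union> {(Inr (v, w), Inl (Inl v)) | v w. v \<in> pverts G \<and> w \<in> pverts H} \<rparr>"

lemma pair_graphI:
  assumes "finite (pverts G)" "parcs G \<subseteq> pverts G \<times> pverts G" "irrefl (parcs G)" "sym (parcs G)"
  shows "pair_graph G"
proof
  show "finite (parcs G)"
    using assms(1,2) by (meson finite_SigmaI finite_subset)
qed (use assms in \<open>auto simp: irrefl_def symmetric_def\<close>)

lemma pair_graph_subdivision_graph:
  assumes "pair_graph G"
  shows "pair_graph (subdivision_graph G)"
proof -
  interpret pair_graph G by fact
  have sub: "uedges G \<subseteq> Pow (pverts G)"
    by (auto simp: uedges_def dest: in_arcsD1 in_arcsD2)
  then have "finite (uedges G)"
    using pair_finite_verts by (meson finite_Pow_iff finite_subset)
  then show ?thesis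
    using sub pair_finite_verts
    by (intro pair_graphI) (auto simp: subdivision_graph_def irrefl_def sym_def)
qed

lemma pair_graph_subdivision_vertex_corona:
  assumes "pair_graph G" "pair_graph H"
  shows "pair_graph (subdivision_vertex_corona G H)"
proof -
  interpret S: pair_graph "subdivision_graph G"
    using assms(1) by (rule pair_graph_subdivision_graph)
  interpret G: pair_graph G by fact
  interpret H: pair_graph H by fact
  have symm: "(t, s) \<in> parcs K" if "symmetric (with_proj K)" "(s, t) \<in> parcs K"
    for K :: "'c pair_pre_digraph" and s t
    using that by (auto simp: symmetric_def dest: symD)
  show ?thesis
  proof (rule pair_graphI)
    show "finite (pverts (subdivision_vertex_corona G H))"
      using S.pair_finite_verts G.pair_finite_verts H.pair_finite_verts
      by (simp add: subdivision_vertex_corona_def)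
    show "irrefl (parcs (subdivision_vertex_corona G H))"
      by (auto simp: subdivision_vertex_corona_def irrefl_def
          dest: S.pair_no_loops H.pair_no_loops)
    show "sym (parcs (subdivision_vertex_corona G H))"
      by (rule symI) (auto simp: subdivision_vertex_corona_def
          intro: symm[OF S.pair_sym_arcs] symm[OF H.pair_sym_arcs])
    have inj: "Inl v \<in> pverts (subdivision_graph G)" if "v \<in> pverts G" for v
      using that by (auto simp: subdivision_graph_def)
    show "parcs (subdivision_vertex_corona G H)
        \<subseteq> pverts (subdivision_vertex_corona G H) \<times> pverts (subdivision_vertex_corona G H)"
      using inj by (auto simp: subdivision_vertex_corona_def
          dest: S.in_arcsD1 S.in_arcsD2 H.in_arcsD1 H.in_arcsD2)
  qed
qed

end

theory Submission
  imports Defs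
begin

text \<open>
  With the vertices ordered as copies of \<open>G\<^sub>2\<close>, edges of \<open>G\<^sub>1\<close>, vertices of \<open>G\<^sub>1\<close>, the matrix
  \<open>x I - L\<close> of the corona has the blocks \<open>I \<otimes> ((x - 1) I - L(G\<^sub>2))\<close>, \<open>(x - 2) I\<close> and
  \<open>(x - r\<^sub>1 - n\<^sub>2) I\<close> on the diagonal; off the diagonal the last one meets the first in
  \<open>I \<otimes> 1\<close> and the second in the incidence matrix \<open>R\<close>. Since the all-ones vector is an
  eigenvector of \<open>(x - 1) I - L(G\<^sub>2)\<close> for the eigenvalue \<open>x - 1\<close>, column operations with the
  factors \<open>1 / (x - 1)\<close> and \<open>1 / (x - 2)\<close> make the matrix block triangular, and
  \<open>R R\<^sup>T = 2 r\<^sub>1 I - L(G\<^sub>1)\<close> turns the remaining block into a multiple of \<open>z I - L(G\<^sub>1)\<close>. This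
  settles all real \<open>x\<close> other than 1 and 2, hence the polynomial identity. The Laplacian is
  positive semidefinite and annihilates the all-ones vector, so its characteristic polynomial splits
  over the reals and its smallest root is 0, which accounts for the missing factor \<open>i = 1\<close>.
\<close>

subsection \<open>Determinants of matrices indexed by lists\<close>

text \<open>Rows and columns carry arbitrary labels, so a graph matrix is a function of vertices,
  and its block structure is that of an append of label lists, with no index arithmetic.\<close>

definition list_mat :: "('i \<Rightarrow> 'j \<Rightarrow> 'c) \<Rightarrow> 'i list \<Rightarrow> 'j list \<Rightarrow> 'c mat" where
  "list_mat f us vs = mat (length us) (length vs) (\<lambda>(i, j). f (us ! i) (vs ! j))"

definition det_on :: "('i \<Rightarrow> 'i \<Rightarrow> 'c :: comm_ring_1) \<Rightarrow> 'i list \<Rightarrow> 'c" where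
  "det_on f vs = det (list_mat f vs vs)"

lemma list_mat_carrier [simp]: "list_mat f us vs \<in> carrier_mat (length us) (length vs)"
  by (simp add: list_mat_def)

lemma dim_list_mat [simp]:
  "dim_row (list_mat f us vs) = length us" "dim_col (list_mat f us vs) = length vs"
  by (simp_all add: list_mat_def)

lemma list_mat_cong:
  assumes "\<And>a b. a \<in> set us \<Longrightarrow> b \<in> set vs \<Longrightarrow> f a b = g a b"
  shows "list_mat f us vs = list_mat g us vs"
  by (rule eq_matI) (use assms in \<open>auto simp: list_mat_def\<close>)

lemma det_on_cong:
  assumes "\<And>a b. a \<in> set vs \<Longrightarrow> b \<in> set vs \<Longrightarrow> f a b = g a b"
  shows "det_on f vs = det_on g vs"
  unfolding det_on_def using list_mat_cong[of vs vs f g] assms by simp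

lemma list_mat_mult:
  assumes "distinct ws"
  shows "list_mat f us ws * list_mat g ws vs
    = list_mat (\<lambda>a b. \<Sum>c\<in>set ws. f a c * g c b) us vs"
proof (rule eq_matI)
  fix i j
  assume "i < dim_row (list_mat (\<lambda>a b. \<Sum>c\<in>set ws. f a c * g c b) us vs)"
    and "j < dim_col (list_mat (\<lambda>a b. \<Sum>c\<in>set ws. f a c * g c b) us vs)"
  then have ij: "i < length us" "j < length vs"
    by simp_all
  have "(\<Sum>c\<in>set ws. f (us ! i) c * g c (vs ! j))
      = (\<Sum>k = 0..<length ws. f (us ! i) (ws ! k) * g (ws ! k) (vs ! j))"
    using assms by (simp add: sum.distinct_set_conv_list sum_list_sum_nth)
  then show "(list_mat f us ws * list_mat g ws vs) $$ (i, j)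
      = list_mat (\<lambda>a b. \<Sum>c\<in>set ws. f a c * g c b) us vs $$ (i, j)"
    using ij by (simp add: list_mat_def scalar_prod_def)
qed auto

lemma list_mat_append:
  "list_mat f (us @ vs) (us' @ vs')
    = four_block_mat (list_mat f us us') (list_mat f us vs') (list_mat f vs us') (list_mat f vs vs')"
  by (rule eq_matI) (auto simp: list_mat_def nth_append)

lemma det_on_Nil [simp]: "det_on f [] = 1"
  by (simp add: det_on_def list_mat_def)

lemma det_on_map: "det_on f (map h vs) = det_on (\<lambda>a b. f (h a) (h b)) vs"
proof -
  have "list_mat f (map h vs) (map h vs) = list_mat (\<lambda>a b. f (h a) (h b)) vs vs"
    by (rule eq_matI) (auto simp: list_mat_def)
  then show ?thesis
    by (simp add: det_on_def)
qed

lemma det_on_smult: "det_on (\<lambda>a b. c * f a b) vs = c ^ length vs * det_on f vs"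
proof -
  have "list_mat (\<lambda>a b. c * f a b) vs vs = c \<cdot>\<^sub>m list_mat f vs vs"
    by (rule eq_matI) (auto simp: list_mat_def)
  then show ?thesis
    by (simp add: det_on_def)
qed

text \<open>Reordering the labels permutes rows and columns by the same permutation, and the two
  signs multiply to 1. Hence a given enumeration of the corona may be exchanged for one adapted to
  the blocks.\<close>

lemma det_on_perm:
  assumes "mset us = mset vs"
  shows "det_on f us = det_on f vs"
proof -
  obtain p where p: "p permutes {..<length vs}" and us: "permute_list p vs = us"
    using assms by (rule mset_eq_permutation)
  let ?n = "length vs"
  let ?A = "list_mat f vs vs"
  let ?B = "mat ?n ?n (\<lambda>(i, j). ?A $$ (p i, j))"
  have p': "p permutes {0..<?n}"
    using p by (simp add: atLeast0LessThan)
  have lt: "p i < ?n" if "i < ?n" for i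
    using permutes_in_image[OF p, of i] that by simp
  have len: "length us = ?n"
    using us by auto
  have nth: "us ! i = vs ! p i" if "i < ?n" for i
    using permute_list_nth[OF p that] us by simp
  \<comment> \<open>The columns are permuted as rows of the transpose; \<open>?B\<close> has only
    its rows permuted.\<close>
  have eq: "transpose_mat (list_mat f us us)
      = mat ?n ?n (\<lambda>(i, j). transpose_mat ?B $$ (p i, j))"
    by (rule eq_matI) (auto simp: list_mat_def len nth lt)
  have "det_on f us = det (transpose_mat (list_mat f us us))"
    unfolding det_on_def by (rule det_transpose[OF list_mat_carrier, symmetric])
  also have "\<dots> = signof p * det (transpose_mat ?B)"
    unfolding eq by (rule det_permute_rows[OF _ p']) simp
  also have "det (transpose_mat ?B) = det ?B"
    by (rule det_transpose[OF mat_carrier])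
  also have "det ?B = signof p * det ?A"
    by (rule det_permute_rows[OF _ p']) simp
  finally show ?thesis
    by (simp add: det_on_def sign_def)
qed

text \<open>
  The columns \<open>y\<close> solve \<open>A Y = - B\<close> for the upper blocks \<open>A\<close>, \<open>B\<close>, so the second factor is the
  Schur complement without an inverse of \<open>A\<close>.
\<close>

lemma det_on_append_eliminate:
  fixes f y :: "'i \<Rightarrow> 'i \<Rightarrow> 'c :: idom"
  assumes "distinct us"
    and y: "\<And>a b. a \<in> set us \<Longrightarrow> b \<in> set vs \<Longrightarrow> (\<Sum>c\<in>set us. f a c * y c b) = - f a b"
  shows "det_on f (us @ vs)
    = det_on f us * det_on (\<lambda>a b. f a b + (\<Sum>c\<in>set us. f a c * y c b)) vs"
proof -
  let ?n = "length us" and ?m = "length vs"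
  let ?A = "list_mat f us us" and ?B = "list_mat f us vs"
  let ?C = "list_mat f vs us" and ?D = "list_mat f vs vs"
  let ?Y = "list_mat y us vs"
  \<comment> \<open>\<open>?T\<close> encodes the column operations: it adds the combinations
    \<open>?A * ?Y\<close> and \<open>?C * ?Y\<close> of the left columns to the right ones. It is
    unit upper triangular, so the determinant is unchanged.\<close>
  let ?T = "four_block_mat (1\<^sub>m ?n) ?Y (0\<^sub>m ?m ?n) (1\<^sub>m ?m)"
  let ?S = "list_mat (\<lambda>a b. f a b + (\<Sum>c\<in>set us. f a c * y c b)) vs vs"
  have AY: "?A * ?Y + ?B = 0\<^sub>m ?n ?m"
    unfolding list_mat_mult[OF assms(1)] by (rule eq_matI) (auto simp: list_mat_def y)
  have CY: "?C * ?Y + ?D = ?S"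
    unfolding list_mat_mult[OF assms(1)] by (rule eq_matI) (auto simp: list_mat_def)
  have "four_block_mat ?A ?B ?C ?D * ?T = four_block_mat (?A * 1\<^sub>m ?n + ?B * 0\<^sub>m ?m ?n)
      (?A * ?Y + ?B * 1\<^sub>m ?m) (?C * 1\<^sub>m ?n + ?D * 0\<^sub>m ?m ?n) (?C * ?Y + ?D * 1\<^sub>m ?m)"
    by (rule mult_four_block_mat) auto
  also have "\<dots> = four_block_mat ?A (0\<^sub>m ?n ?m) ?C ?S"
    using AY CY by (simp add: right_mult_one_mat[of _ ?n] right_mult_one_mat[of _ ?m]
        right_mult_zero_mat[of _ _ ?m] right_add_zero_mat[of _ _ ?n] list_mat_def)
  finally have eq: "four_block_mat ?A ?B ?C ?D * ?T = four_block_mat ?A (0\<^sub>m ?n ?m) ?C ?S" .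
  have "det ?T = det (1\<^sub>m ?n :: 'c mat) * det (1\<^sub>m ?m :: 'c mat)"
    by (rule det_four_block_mat_lower_left_zero) auto
  then have "det ?T = 1"
    by simp
  moreover have "det (four_block_mat ?A ?B ?C ?D * ?T) = det (four_block_mat ?A ?B ?C ?D) * det ?T"
    by (rule det_mult[of _ "?n + ?m"]) auto
  moreover have "det (four_block_mat ?A (0\<^sub>m ?n ?m) ?C ?S) = det ?A * det ?S"
    by (rule det_four_block_mat_upper_right_zero) auto
  ultimately show ?thesis
    unfolding det_on_def list_mat_append eq by simp
qed

lemma det_on_append_block:
  fixes f :: "'i \<Rightarrow> 'i \<Rightarrow> 'c :: idom"
  assumes "\<And>a b. a \<in> set us \<Longrightarrow> b \<in> set vs \<Longrightarrow> f a b = 0"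
  shows "det_on f (us @ vs) = det_on f us * det_on f vs"
proof -
  have "list_mat f us vs = 0\<^sub>m (length us) (length vs)"
    by (rule eq_matI) (use assms in \<open>auto simp: list_mat_def\<close>)
  then show ?thesis
    unfolding det_on_def list_mat_append by (intro det_four_block_mat_upper_right_zero) auto
qed

lemma det_on_diagonal:
  fixes f :: "'i \<Rightarrow> 'i \<Rightarrow> 'c :: idom"
  assumes "distinct vs"
    and "\<And>a b. a \<in> set vs \<Longrightarrow> b \<in> set vs \<Longrightarrow> f a b = (if a = b then c else 0)"
  shows "det_on f vs = c ^ length vs"
proof -
  have "list_mat f vs vs = c \<cdot>\<^sub>m 1\<^sub>m (length vs)"
    by (rule eq_matI) (use assms in \<open>auto simp: list_mat_def nth_eq_iff_index_eq\<close>)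
  then show ?thesis
    by (simp add: det_on_def)
qed

text \<open>The list runs through one copy after the other, so the matrix is block diagonal with all
  blocks equal to \<open>g\<close>; the induction splits off one block at a time.\<close>

lemma det_on_copies:
  fixes f :: "'i \<Rightarrow> 'i \<Rightarrow> 'c :: idom"
  assumes "distinct us"
    and "\<And>u u' w w'. u \<in> set us \<Longrightarrow> u' \<in> set us \<Longrightarrow> w \<in> set ws \<Longrightarrow> w' \<in> set ws
      \<Longrightarrow> f (h u w) (h u' w') = (if u = u' then g w w' else 0)"
  shows "det_on f (concat (map (\<lambda>u. map (h u) ws) us)) = det_on g ws ^ length us"
  using assms
proof (induction us)
  case (Cons u us)
  have "det_on f (map (h u) ws @ concat (map (\<lambda>u. map (h u) ws) us))
      = det_on f (map (h u) ws) * det_on f (concat (map (\<lambda>u. map (h u) ws) us))"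
    by (rule det_on_append_block) (use Cons.prems in auto)
  moreover have "det_on f (map (h u) ws) = det_on g ws"
    unfolding det_on_map by (rule det_on_cong) (use Cons.prems in auto)
  moreover have "det_on f (concat (map (\<lambda>u. map (h u) ws) us)) = det_on g ws ^ length us"
    by (rule Cons.IH) (use Cons.prems in auto)
  ultimately show ?case
    by simp
qed simp

subsection \<open>Laplacian eigenvalues\<close>

text \<open>This is the Rayleigh quotient argument; the sum in \<open>eig\<close> is row
  \<open>i\<close> of \<open>L x\<close> for weights \<open>A\<close>. The vector is complex because
  the roots to which it is applied are known only as complex numbers.\<close>

lemma complex_eigenvalue_weighted_laplacian:
  fixes A :: "nat \<Rightarrow> nat \<Rightarrow> real" and x :: "nat \<Rightarrow> complex"
  assumes nonneg: "\<And>i j. 0 \<le> A i j" and sym: "\<And>i j. A i j = A j i"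
    and eig: "\<And>i. i < n \<Longrightarrow> (\<Sum>j<n. A i j * (x i - x j)) = \<theta> * x i"
    and "k < n" "x k \<noteq> 0"
  shows "\<theta> \<in> \<real> \<and> 0 \<le> Re \<theta>"
proof -
  let ?T = "\<Sum>i<n. \<Sum>j<n. A i j * (cnj (x i) * (x i - x j))"
  define s where "s = (\<Sum>i<n. (cmod (x i))\<^sup>2)"
  define t where "t = (\<Sum>i<n. \<Sum>j<n. A i j * (cmod (x i - x j))\<^sup>2)"
  have "?T = (\<Sum>i<n. cnj (x i) * (\<Sum>j<n. A i j * (x i - x j)))"
    by (simp add: sum_distrib_left mult.left_commute)
  also have "\<dots> = (\<Sum>i<n. \<theta> * of_real ((cmod (x i))\<^sup>2))"
    by (intro sum.cong) (simp_all add: eig complex_norm_square mult_ac del: of_real_power)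
  also have "\<dots> = \<theta> * s"
    by (simp add: s_def sum_distrib_left)
  finally have T: "?T = \<theta> * s" .
  \<comment> \<open>Symmetrizing \<open>x\<^sup>* L x\<close> gives half the Dirichlet form, which is real and nonnegative.\<close>
  have "?T = (\<Sum>i<n. \<Sum>j<n. A i j * (cnj (x j) * (x j - x i)))"
    by (subst sum.swap) (simp add: sym)
  then have "2 * ?T = (\<Sum>i<n. \<Sum>j<n. A i j * (cnj (x i) * (x i - x j)) + A i j * (cnj (x j) * (x j - x i)))"
    by (simp only: sum.distrib mult_2)
  also have "\<dots> = of_real t"
    unfolding t_def of_real_sum
    by (intro sum.cong refl) (simp add: complex_norm_square algebra_simps del: of_real_power)
  finally have "2 * (\<theta> * s) = of_real t"
    unfolding T .
  moreover have "0 < s"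
    unfolding s_def by (rule sum_pos2[of _ k]) (use assms in auto)
  ultimately have "\<theta> = of_real (t / (2 * s))"
    by (simp add: field_simps)
  moreover have "0 \<le> t"
    unfolding t_def by (intro sum_nonneg mult_nonneg_nonneg nonneg) auto
  ultimately show ?thesis
    using \<open>0 < s\<close> by simp
qed

lemma out_degree_with_proj: "out_degree (with_proj G) v = card {w. (v, w) \<in> parcs G}"
proof -
  have "out_arcs (with_proj G) v = Pair v ` {w. (v, w) \<in> parcs G}"
    by (auto simp: out_arcs_def)
  then show ?thesis
    by (simp add: out_degree_def card_image inj_on_def)
qed

lemma pair_graph_parcs_sym:
  assumes "pair_graph G"
  shows "(v, w) \<in> parcs G \<longleftrightarrow> (w, v) \<in> parcs G"
proof -
  interpret pair_graph G by fact
  show ?thesis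
    using arcs_symmetric by blast
qed

lemma out_degree_eq_sum:
  assumes "pair_graph G" "enumerates vs (pverts G)"
  shows "real (out_degree (with_proj G) v) = (\<Sum>j<length vs. if (v, vs ! j) \<in> parcs G then 1 else 0)"
proof -
  interpret pair_graph G by fact
  have vs: "distinct vs" "set vs = pverts G"
    using assms(2) by (auto simp: enumerates_def)
  have "{w. (v, w) \<in> parcs G} = {w \<in> set vs. (v, w) \<in> parcs G}"
    using vs(2) by (auto dest: in_arcsD2)
  then have "real (out_degree (with_proj G) v) = (\<Sum>w\<in>set vs. if (v, w) \<in> parcs G then 1 else 0)"
    by (simp add: out_degree_with_proj sum.If_cases Int_def)
  also have "\<dots> = (\<Sum>j<length vs. if (v, vs ! j) \<in> parcs G then 1 else 0)"
    using vs(1) by (simp add: sum.distinct_set_conv_list sum_list_sum_nth atLeast0LessThan)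
  finally show ?thesis .
qed

lemma dim_laplacian_matrix [simp]:
  "dim_row (laplacian_matrix vs G) = length vs" "dim_col (laplacian_matrix vs G) = length vs"
  by (simp_all add: laplacian_matrix_def adjacency_matrix_def)

lemma laplacian_matrix_carrier [simp]:
  "laplacian_matrix vs G \<in> carrier_mat (length vs) (length vs)"
  by (rule carrier_matI) simp_all

lemma laplacian_matrix_index:
  assumes "distinct vs" "i < length vs" "j < length vs"
  shows "laplacian_matrix vs G $$ (i, j) = (if vs ! i = vs ! j then real (out_degree (with_proj G) (vs ! i)) else 0)
    - (if (vs ! i, vs ! j) \<in> parcs G then 1 else 0)"
  using assms
  by (auto simp: laplacian_matrix_def degree_matrix_def adjacency_matrix_def mat_diag_def
      nth_eq_iff_index_eq)

text \<open>The diagonal entry is the sum of the adjacency row, which pairs each neighbour term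
  \<open>x $ j\<close> with one \<open>x $ i\<close>. The general field type serves both complex
  eigenvectors and the real all-ones vector.\<close>

lemma laplacian_matrix_mult_vec:
  fixes x :: "'c :: real_field vec"
  assumes "pair_graph G" "enumerates vs (pverts G)" "i < length vs" "x \<in> carrier_vec (length vs)"
  shows "(map_mat of_real (laplacian_matrix vs G) *\<^sub>v x) $ i
    = (\<Sum>j<length vs. of_real (if (vs ! i, vs ! j) \<in> parcs G then 1 else 0) * (x $ i - x $ j))"
proof -
  have vs: "distinct vs"
    using assms(2) by (auto simp: enumerates_def)
  let ?a = "\<lambda>j. of_real (if (vs ! i, vs ! j) \<in> parcs G then 1 else 0) :: 'c"
  have "(map_mat of_real (laplacian_matrix vs G) *\<^sub>v x) $ i
      = (\<Sum>j<length vs. of_real (laplacian_matrix vs G $$ (i, j)) * x $ j)"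
    using assms by (auto simp: scalar_prod_def atLeast0LessThan intro!: sum.cong)
  also have "\<dots> = (\<Sum>j<length vs. (if i = j then of_real (real (out_degree (with_proj G) (vs ! i))) * x $ j else 0)
      - ?a j * x $ j)"
    using assms(3) vs
    by (intro sum.cong) (auto simp: laplacian_matrix_index nth_eq_iff_index_eq algebra_simps)
  also have "\<dots> = of_real (real (out_degree (with_proj G) (vs ! i))) * x $ i - (\<Sum>j<length vs. ?a j * x $ j)"
    using assms(3) by (simp add: sum_subtractf)
  also have "\<dots> = (\<Sum>j<length vs. ?a j * (x $ i - x $ j))"
    unfolding out_degree_eq_sum[OF assms(1,2)] of_real_sum sum_distrib_right
    by (simp add: sum_subtractf algebra_simps)
  finally show ?thesis .
qed

lemma complex_root_char_poly_laplacian: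
  assumes "pair_graph G" "enumerates vs (pverts G)"
    and "poly (char_poly (map_mat complex_of_real (laplacian_matrix vs G))) \<theta> = 0"
  shows "\<theta> \<in> \<real> \<and> 0 \<le> Re \<theta>"
proof -
  let ?n = "length vs"
  let ?L = "map_mat complex_of_real (laplacian_matrix vs G)"
  have L: "?L \<in> carrier_mat ?n ?n"
    by simp
  then obtain x where x: "x \<in> carrier_vec ?n" "x \<noteq> 0\<^sub>v ?n" "?L *\<^sub>v x = \<theta> \<cdot>\<^sub>v x"
    using assms(3) eigenvalue_root_char_poly[OF L] unfolding eigenvalue_def eigenvector_def by auto
  then obtain k where k: "k < ?n" "x $ k \<noteq> 0"
    by (metis carrier_vecD eq_vecI index_zero_vec)
  define A :: "nat \<Rightarrow> nat \<Rightarrow> real" where "A i j = (if (vs ! i, vs ! j) \<in> parcs G then 1 else 0)" for i j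
  show ?thesis
  proof (rule complex_eigenvalue_weighted_laplacian[of A ?n "\<lambda>i. x $ i" \<theta> k])
    show "A i j = A j i" for i j
      using pair_graph_parcs_sym[OF assms(1), of "vs ! i" "vs ! j"] by (simp add: A_def)
    show "(\<Sum>j<?n. A i j * (x $ i - x $ j)) = \<theta> * x $ i" if "i < ?n" for i
      using laplacian_matrix_mult_vec[OF assms(1,2) that x(1)] x that by (simp add: A_def)
  qed (use k in \<open>auto simp: A_def\<close>)
qed

section \<open>Splitting of the Laplacian characteristic polynomial and its least root\<close>

lemma sorted_list_of_multiset_0_Min:
  assumes "x \<in># M" "\<And>y. y \<in># M \<Longrightarrow> x \<le> y"
  shows "sorted_list_of_multiset M ! 0 = x"
proof -
  let ?l = "sorted_list_of_multiset M"
  have set: "set ?l = set_mset M"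
    by simp
  have sorted: "sorted ?l"
    by simp
  obtain i where "i < length ?l" "?l ! i = x"
    using assms(1) set by (metis in_set_conv_nth)
  then have "?l ! 0 \<le> x" "?l ! 0 \<in> set ?l"
    using sorted_nth_mono[OF sorted, of 0 i] by (auto intro!: nth_mem simp del: set_sorted_list_of_multiset)
  then show ?thesis
    using assms(2) set by (simp add: order_antisym)
qed

lemma proots_prod_list_linear: "proots (\<Prod>a\<leftarrow>as. [:- a, 1:]) = mset as" for as :: "'a :: idom list"
proof (induction as)
  case (Cons a as)
  have "(\<Prod>a\<leftarrow>as. [:- a, 1:]) \<noteq> 0"
    by (auto simp: prod_list_zero_iff)
  then have "proots ([:- a, 1:] * (\<Prod>a\<leftarrow>as. [:- a, 1:])) = {#a#} + proots (\<Prod>a\<leftarrow>as. [:- a, 1:])"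
    by (subst proots_mult) auto
  then show ?case
    using Cons.IH by (simp del: mult_pCons_left)
qed simp

text \<open>Over the complex numbers the polynomial splits, and all its roots are real and
  nonnegative. The factorization descends along the injective map \<open>of_real\<close>, and the
  root 0 must then come first in sorted order.\<close>

lemma char_poly_laplacian:
  assumes "pair_graph G" "enumerates vs (pverts G)"
  shows "char_poly (laplacian_matrix vs G) = (\<Prod>i = 1..length vs. [:- laplacian_eigenvalue vs G i, 1:])"
    and "vs \<noteq> [] \<Longrightarrow> laplacian_eigenvalue vs G 1 = 0"
proof -
  let ?n = "length vs"
  let ?L = "laplacian_matrix vs G"
  interpret of_real: map_poly_inj_comm_ring_hom "complex_of_real"
    by unfold_locales auto
  have "map_mat complex_of_real ?L \<in> carrier_mat ?n ?n"
    by simp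
  from char_poly_factorized[OF this] obtain as where
    as: "char_poly (map_mat complex_of_real ?L) = (\<Prod>a\<leftarrow>as. [:- a, 1:])" and len: "length as = ?n"
    by blast
  have root: "a \<in> \<real> \<and> 0 \<le> Re a" if "a \<in> set as" for a
    by (rule complex_root_char_poly_laplacian[OF assms])
      (use that in \<open>auto simp: as poly_prod_list prod_list_zero_iff\<close>)
  have "map_poly complex_of_real (char_poly ?L) = (\<Prod>a\<leftarrow>as. [:- a, 1:])"
    unfolding as[symmetric] by (rule of_real_hom.char_poly_hom[OF laplacian_matrix_carrier, symmetric])
  also have "\<dots> = (\<Prod>a\<leftarrow>as. map_poly complex_of_real [:- Re a, 1:])"
    by (rule arg_cong[of _ _ prod_list], rule map_cong) (use root in \<open>auto simp: Reals_def\<close>)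
  also have "\<dots> = map_poly complex_of_real (\<Prod>a\<leftarrow>map Re as. [:- a, 1:])"
    by (simp add: of_real.hom_prod_list o_def)
  finally have fact: "char_poly ?L = (\<Prod>a\<leftarrow>map Re as. [:- a, 1:])"
    by simp
  \<comment> \<open>This is the list inside \<open>laplacian_eigenvalue\<close>. Since it has
    exactly \<open>?n\<close> entries, the numbers 1 to \<open>?n\<close> all address genuine
    roots.\<close>
  define l where "l = sorted_list_of_multiset (proots (char_poly ?L))"
  have proots: "proots (char_poly ?L) = mset (map Re as)"
    unfolding fact by (rule proots_prod_list_linear)
  have mset_l: "mset l = mset (map Re as)"
    by (simp add: l_def proots)
  then have length_l: "length l = ?n"
    using len by (metis length_map size_mset)
  have "char_poly ?L = (\<Prod>a\<leftarrow>l. [:- a, 1:])"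
    unfolding fact using arg_cong[OF mset_l, of "\<lambda>M. prod_mset (image_mset (\<lambda>a. [:- a, 1:]) M)"]
    by (simp only: mset_map[symmetric] prod_mset_prod_list)
  also have "\<dots> = (\<Prod>i<?n. [:- (l ! i), 1:])"
    by (simp add: prod.list_conv_set_nth length_l atLeast0LessThan)
  also have "\<dots> = (\<Prod>i = 1..?n. [:- laplacian_eigenvalue vs G i, 1:])"
    \<comment> \<open>Eigenvalues are numbered from 1, list positions from 0.\<close>
    by (rule prod.reindex_bij_witness[of _ "\<lambda>i. i - 1" Suc])
      (auto simp: laplacian_eigenvalue_def l_def)
  finally show "char_poly ?L = (\<Prod>i = 1..?n. [:- laplacian_eigenvalue vs G i, 1:])" .
  show "laplacian_eigenvalue vs G 1 = 0" if "vs \<noteq> []"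
  proof -
    \<comment> \<open>On the all-ones vector every difference \<open>x $ i - x $ j\<close> vanishes,
      so it lies in the kernel of the Laplacian.\<close>
    let ?x = "vec ?n (\<lambda>_. 1 :: real)"
    have "map_mat of_real ?L *\<^sub>v ?x = 0 \<cdot>\<^sub>v ?x"
    proof (rule eq_vecI)
      fix i assume "i < dim_vec (0 \<cdot>\<^sub>v ?x)"
      then have "i < ?n" by simp
      then show "(map_mat of_real ?L *\<^sub>v ?x) $ i = (0 \<cdot>\<^sub>v ?x) $ i"
        by (subst laplacian_matrix_mult_vec[OF assms]) auto
    qed (use laplacian_matrix_carrier[of vs G] in auto)
    moreover have "?x \<noteq> 0\<^sub>v ?n"
    proof
      assume "?x = 0\<^sub>v ?n"
      then have "?x $ 0 = 0\<^sub>v ?n $ 0" by simp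
      with that show False by simp
    qed
    moreover have "map_mat of_real ?L = ?L"
      by (rule eq_matI) auto
    ultimately have "eigenvalue ?L 0"
      unfolding eigenvalue_def eigenvector_def using laplacian_matrix_carrier[of vs G]
      by (intro exI[of _ ?x]) auto
    then have "poly (char_poly ?L) 0 = 0"
      using eigenvalue_root_char_poly[OF laplacian_matrix_carrier] by blast
    moreover have "char_poly ?L \<noteq> 0"
      using degree_monic_char_poly[OF laplacian_matrix_carrier, of vs G] by force
    ultimately have "0 \<in># proots (char_poly ?L)"
      by simp
    moreover have "0 \<le> y" if "y \<in># proots (char_poly ?L)" for y
      using that root unfolding proots by auto
    ultimately show ?thesis
      unfolding laplacian_eigenvalue_def by (simp add: sorted_list_of_multiset_0_Min)
  qed
qed

subsection \<open>The subdivision-vertex corona\<close>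

text \<open>The entries of \<open>x I - L\<close>, indexed by vertices; the adjacency term is
  positive because \<open>L = D - A\<close>.\<close>

definition laplacian_char :: "real \<Rightarrow> 'a pair_pre_digraph \<Rightarrow> 'a \<Rightarrow> 'a \<Rightarrow> real" where
  "laplacian_char x G v w = (if v = w then x - real (out_degree (with_proj G) v) else 0)
    + (if (v, w) \<in> parcs G then 1 else 0)"

lemma poly_char_poly_laplacian:
  assumes "distinct vs"
  shows "poly (char_poly (laplacian_matrix vs G)) x = det_on (laplacian_char x G) vs"
  unfolding char_poly_def det_on_def
proof (rule poly_det_cong)
  fix i j assume ij: "i < length vs" "j < length vs"
  then show "poly (char_poly_matrix (laplacian_matrix vs G) $$ (i, j)) x
      = list_mat (laplacian_char x G) vs vs $$ (i, j)"
    using laplacian_matrix_carrier[of vs G] laplacian_matrix_index[OF assms ij, of G] assms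
    by (auto simp: char_poly_matrix_def list_mat_def laplacian_char_def nth_eq_iff_index_eq)
qed simp_all

text \<open>The rows of \<open>L\<close> sum to 0, so the all-ones vector is an eigenvector of
  \<open>x I - L\<close> for the eigenvalue \<open>x\<close>. This is what allows the copies to be
  eliminated without inverting their blocks.\<close>

lemma sum_laplacian_char:
  assumes "pair_graph G" "v \<in> pverts G"
  shows "(\<Sum>w\<in>pverts G. laplacian_char x G v w) = x"
proof -
  interpret pair_graph G by fact
  have fin: "finite (pverts G)"
    by (rule pair_finite_verts)
  have "{w. (v, w) \<in> parcs G} = pverts G \<inter> {w. (v, w) \<in> parcs G}"
    by (auto dest: in_arcsD2)
  then show ?thesis
    using assms(2) fin
    by (simp add: laplacian_char_def sum.distrib out_degree_with_proj sum.If_cases)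
qed

section \<open>Undirected edges and the entries of \<open>R R\<^sup>T\<close>\<close>

lemma finite_uedges:
  assumes "pair_graph G"
  shows "finite (uedges G)"
proof -
  interpret pair_graph G by fact
  have "uedges G = (\<lambda>(u, v). {u, v}) ` parcs G"
    by (auto simp: uedges_def)
  then show ?thesis
    using pair_finite_arcs by simp
qed

lemma uedges_mem_iff:
  assumes "pair_graph G"
  shows "{v, w} \<in> uedges G \<longleftrightarrow> (v, w) \<in> parcs G"
  using pair_graph_parcs_sym[OF assms] by (auto simp: uedges_def doubleton_eq_iff)

lemma card_uedge:
  assumes "pair_graph G" "e \<in> uedges G"
  shows "card e = 2"
proof -
  interpret pair_graph G by fact
  show ?thesis
    using assms(2) by (auto simp: uedges_def card_insert_if dest: pair_no_loops)
qed

text \<open>Edges at \<open>v\<close> correspond to neighbours of \<open>v\<close>. The count is the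
  diagonal entry of \<open>R R\<^sup>T\<close> for the incidence matrix \<open>R\<close>.\<close>

lemma card_incident_uedges:
  assumes "pair_graph G"
  shows "card {e \<in> uedges G. v \<in> e} = out_degree (with_proj G) v"
proof -
  have "{e \<in> uedges G. v \<in> e} = (\<lambda>w. {v, w}) ` {w. (v, w) \<in> parcs G}"
    using pair_graph_parcs_sym[OF assms] by (auto simp: uedges_def)
  moreover have "inj_on (\<lambda>w. {v, w}) {w. (v, w) \<in> parcs G}"
    by (auto simp: inj_on_def doubleton_eq_iff)
  ultimately show ?thesis
    by (simp add: card_image out_degree_with_proj)
qed

text \<open>The only edge that can contain two distinct vertices is \<open>{v, w}\<close> itself.
  The count is the off-diagonal entry of \<open>R R\<^sup>T\<close>, which thus equals
  \<open>D + A\<close>.\<close>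

lemma card_common_uedges:
  assumes "pair_graph G" "v \<noteq> w"
  shows "card {e \<in> uedges G. v \<in> e \<and> w \<in> e} = (if (v, w) \<in> parcs G then 1 else 0)"
proof -
  have "{e \<in> uedges G. v \<in> e \<and> w \<in> e} = (if (v, w) \<in> parcs G then {{v, w}} else {})"
    using assms(2) pair_graph_parcs_sym[OF assms(1)]
    by (auto simp: uedges_mem_iff[OF assms(1)]) (auto simp: uedges_def)
  then show ?thesis
    by simp
qed

section \<open>Arcs and degrees of the corona, block by block\<close>

lemma parcs_corona:
  "(Inl (Inl v), Inl (Inl v')) \<notin> parcs (subdivision_vertex_corona G H)"
  "(Inl (Inl v), Inl (Inr e)) \<in> parcs (subdivision_vertex_corona G H) \<longleftrightarrow> e \<in> uedges G \<and> v \<in> e"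
  "(Inl (Inr e), Inl (Inl v)) \<in> parcs (subdivision_vertex_corona G H) \<longleftrightarrow> e \<in> uedges G \<and> v \<in> e"
  "(Inl (Inr e), Inl (Inr e')) \<notin> parcs (subdivision_vertex_corona G H)"
  "(Inl (Inr e), Inr p) \<notin> parcs (subdivision_vertex_corona G H)"
  "(Inr p, Inl (Inr e)) \<notin> parcs (subdivision_vertex_corona G H)"
  "(Inl (Inl v), Inr (v', w)) \<in> parcs (subdivision_vertex_corona G H)
    \<longleftrightarrow> v' = v \<and> v \<in> pverts G \<and> w \<in> pverts H"
  "(Inr (v', w), Inl (Inl v)) \<in> parcs (subdivision_vertex_corona G H)
    \<longleftrightarrow> v' = v \<and> v \<in> pverts G \<and> w \<in> pverts H"
  "(Inr (v, w), Inr (v', w')) \<in> parcs (subdivision_vertex_corona G H)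
    \<longleftrightarrow> v' = v \<and> v \<in> pverts G \<and> (w, w') \<in> parcs H"
  by (auto simp: subdivision_vertex_corona_def subdivision_graph_def)

lemma out_degree_corona_vertex:
  assumes "pair_graph G" "pair_graph H" "v \<in> pverts G"
  shows "out_degree (with_proj (subdivision_vertex_corona G H)) (Inl (Inl v))
    = out_degree (with_proj G) v + card (pverts H)"
proof -
  interpret H: pair_graph H by fact
  have "{t. (Inl (Inl v), t) \<in> parcs (subdivision_vertex_corona G H)}
      = (Inl \<circ> Inr) ` {e \<in> uedges G. v \<in> e} \<union> (\<lambda>w. Inr (v, w)) ` pverts H" (is "_ = ?A \<union> ?B")
    using assms(3) by (auto simp: subdivision_vertex_corona_def subdivision_graph_def)
  moreover have "card (?A \<union> ?B) = card ?A + card ?B"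
    using finite_uedges[OF assms(1)] H.pair_finite_verts by (intro card_Un_disjoint) auto
  moreover have "card ?A = out_degree (with_proj G) v"
    by (subst card_image) (auto simp: inj_on_def card_incident_uedges[OF assms(1)])
  moreover have "card ?B = card (pverts H)"
    by (rule card_image) (auto simp: inj_on_def)
  ultimately show ?thesis
    by (simp add: out_degree_with_proj)
qed

lemma out_degree_corona_edge:
  assumes "pair_graph G" "e \<in> uedges G"
  shows "out_degree (with_proj (subdivision_vertex_corona G H)) (Inl (Inr e)) = 2"
proof -
  have "{t. (Inl (Inr e), t) \<in> parcs (subdivision_vertex_corona G H)} = (Inl \<circ> Inl) ` e"
    using assms(2) by (auto simp: subdivision_vertex_corona_def subdivision_graph_def)
  moreover have "card ((Inl \<circ> Inl) ` e) = card e"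
    by (rule card_image) (auto simp: inj_on_def)
  ultimately show ?thesis
    by (simp add: out_degree_with_proj card_uedge[OF assms])
qed

text \<open>The additional neighbour is the vertex of \<open>G\<close> to which the copy is joined.
  It shifts the parameter, so a copy contributes the block \<open>(x - 1) I - L(H)\<close>.\<close>

lemma out_degree_corona_copy:
  fixes G :: "'a pair_pre_digraph" and H :: "'b pair_pre_digraph"
  assumes "pair_graph H" "v \<in> pverts G" "w \<in> pverts H"
  shows "out_degree (with_proj (subdivision_vertex_corona G H)) (Inr (v, w))
    = out_degree (with_proj H) w + 1"
proof -
  interpret H: pair_graph H by fact
  let ?copy = "\<lambda>w'. Inr (v, w') :: ('a + 'a set) + 'a \<times> 'b"
  have "{w'. (w, w') \<in> parcs H} \<subseteq> pverts H"
    by (auto dest: H.in_arcsD2)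
  then have "finite {w'. (w, w') \<in> parcs H}"
    using H.pair_finite_verts finite_subset by blast
  then have "card (insert (Inl (Inl v)) (?copy ` {w'. (w, w') \<in> parcs H}))
      = Suc (card (?copy ` {w'. (w, w') \<in> parcs H}))"
    by (intro card_insert_disjoint finite_imageI) auto
  moreover have "card (?copy ` {w'. (w, w') \<in> parcs H}) = card {w'. (w, w') \<in> parcs H}"
    by (rule card_image) (auto simp: inj_on_def)
  moreover have "{t. (Inr (v, w), t) \<in> parcs (subdivision_vertex_corona G H)}
      = insert (Inl (Inl v)) (?copy ` {w'. (w, w') \<in> parcs H})"
    using assms(2,3) by (auto simp: subdivision_vertex_corona_def subdivision_graph_def)
  ultimately show ?thesis
    by (simp only: out_degree_with_proj Suc_eq_plus1)
qed

text \<open>The factors are the determinants of the copy block, the edge block and the Schur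
  complement. With \<open>k = x - r - n' - n' / (x - 1)\<close> the latter is
  \<open>k I - R R\<^sup>T / (x - 2)\<close>; inserting \<open>R R\<^sup>T = 2 r I - L(G)\<close>
  and pulling out \<open>- 1 / (x - 2)\<close> leaves \<open>z I - L(G)\<close> with
  \<open>z = 2 r - (x - 2) k\<close>.\<close>

lemma poly_char_poly_corona:
  fixes G :: "'a pair_pre_digraph" and H :: "'b pair_pre_digraph" and x :: real
  defines "n \<equiv> card (pverts G)" and "m \<equiv> card (uedges G)" and "n' \<equiv> card (pverts H)"
  assumes reg: "regular_graph r G" and H: "pair_graph H"
    and us: "enumerates us (pverts G)" and ws: "enumerates ws (pverts H)"
    and vs: "enumerates vs (pverts (subdivision_vertex_corona G H))"
    and x: "x \<noteq> 1" "x \<noteq> 2"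
  defines "z \<equiv> 2 * real r - (x - 2) * (x - r - n' - n' / (x - 1))"
  shows "poly (char_poly (laplacian_matrix vs (subdivision_vertex_corona G H))) x
    = poly (char_poly (laplacian_matrix ws H)) (x - 1) ^ n * (x - 2) ^ m
      * ((- 1 / (x - 2)) ^ n * poly (char_poly (laplacian_matrix us G)) z)"
proof -
  let ?C = "subdivision_vertex_corona G H"
  let ?f = "laplacian_char x ?C"
  have G: "pair_graph G" and deg: "\<And>v. v \<in> pverts G \<Longrightarrow> out_degree (with_proj G) v = r"
    using reg by (auto simp: regular_graph_def)
  interpret G: pair_graph G by fact
  interpret H: pair_graph H by fact
  have dist: "distinct us" "distinct ws" "distinct vs" and sets: "set us = pverts G"
      "set ws = pverts H" "set vs = pverts ?C"
    using us ws vs by (auto simp: enumerates_def)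
  have len: "length us = n" "length ws = n'"
    using dist sets by (auto simp: n_def n'_def dest: distinct_card)
  obtain es where es: "set es = uedges G" "distinct es"
    using finite_distinct_list[OF finite_uedges[OF G]] by blast
  then have len_es: "length es = m"
    by (auto simp: m_def dest: distinct_card)
  have fin: "finite (pverts G)" "finite (pverts H)" "finite (uedges G)"
    using G.pair_finite_verts H.pair_finite_verts finite_uedges[OF G] by auto
  define copy :: "'a \<Rightarrow> 'b \<Rightarrow> ('a + 'a set) + 'a \<times> 'b" where "copy = (\<lambda>v w. Inr (v, w))"
  define edge :: "'a set \<Rightarrow> ('a + 'a set) + 'a \<times> 'b" where "edge = (\<lambda>e. Inl (Inr e))"
  define vert :: "'a \<Rightarrow> ('a + 'a set) + 'a \<times> 'b" where "vert = (\<lambda>v. Inl (Inl v))"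
  note defs = copy_def edge_def vert_def
  define cs where "cs = concat (map (\<lambda>v. map (copy v) ws) us)"
  let ?es = "map edge es" and ?us = "map vert us"
  have set_cs: "set cs = (\<lambda>(v, w). copy v w) ` (pverts G \<times> pverts H)"
    by (auto simp: cs_def sets)
  have "distinct cs"
    unfolding cs_def using dist by (induction us) (auto simp: distinct_map inj_on_def defs)
  then have dist_ce: "distinct (cs @ ?es)"
    using es by (auto simp: set_cs distinct_map inj_on_def defs)
  moreover have "set (cs @ ?es @ ?us) = pverts ?C"
    by (auto simp: set_cs es sets defs subdivision_vertex_corona_def subdivision_graph_def)
  moreover have "distinct (cs @ ?es @ ?us)"
    using dist_ce dist by (auto simp: set_cs distinct_map inj_on_def defs)
  ultimately have "mset vs = mset ((cs @ ?es) @ ?us)"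
    using dist(3) sets(3) by (simp only: set_eq_iff_mset_eq_distinct[symmetric] append_assoc)

  have sum_ce: "(\<Sum>c\<in>set (cs @ ?es). F c)
      = (\<Sum>v\<in>pverts G. \<Sum>w\<in>pverts H. F (copy v w)) + (\<Sum>e\<in>uedges G. F (edge e))" for F :: "_ \<Rightarrow> real"
  proof -
    have "(\<Sum>c\<in>set (cs @ ?es). F c) = (\<Sum>c\<in>set cs. F c) + (\<Sum>c\<in>edge ` uedges G. F c)"
      unfolding set_append set_map es by (rule sum.union_disjoint) (auto simp: fin set_cs defs)
    also have "(\<Sum>c\<in>set cs. F c) = (\<Sum>v\<in>pverts G. \<Sum>w\<in>pverts H. F (copy v w))"
      unfolding set_cs sum.cartesian_product
      by (subst sum.reindex) (auto simp: inj_on_def defs intro!: sum.cong)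
    also have "(\<Sum>c\<in>edge ` uedges G. F c) = (\<Sum>e\<in>uedges G. F (edge e))"
      by (subst sum.reindex) (auto simp: inj_on_def defs)
    finally show ?thesis .
  qed

  have f_cc: "?f (copy v w) (copy v' w') = (if v = v' then laplacian_char (x - 1) H w w' else 0)"
    if "v \<in> pverts G" "w \<in> pverts H" for v w v' w'
    using that by (auto simp: laplacian_char_def defs parcs_corona out_degree_corona_copy[OF H])
  have f_ce: "?f (copy v w) (edge e) = 0" "?f (edge e) (copy v w) = 0" for v w e
    by (auto simp: laplacian_char_def defs parcs_corona)
  have f_cv: "?f (copy v w) (vert u) = (if v = u then 1 else 0)"
      "?f (vert u) (copy v w) = (if v = u then 1 else 0)"
    if "u \<in> pverts G" "w \<in> pverts H" for v w u
    using that by (auto simp: laplacian_char_def defs parcs_corona)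
  have f_ee: "?f (edge e) (edge e') = (if e = e' then x - 2 else 0)" if "e \<in> uedges G" for e e'
    using that by (auto simp: laplacian_char_def defs parcs_corona out_degree_corona_edge[OF G])
  have f_ev: "?f (edge e) (vert u) = (if u \<in> e then 1 else 0)"
      "?f (vert u) (edge e) = (if u \<in> e then 1 else 0)" if "e \<in> uedges G" for e u
    using that by (auto simp: laplacian_char_def defs parcs_corona)
  have f_vv: "?f (vert u) (vert u') = (if u = u' then x - r - n' else 0)" if "u \<in> pverts G" for u u'
    using that by (auto simp: laplacian_char_def defs parcs_corona out_degree_corona_vertex[OF G H]
        deg n'_def)

  \<comment> \<open>The solution of \<open>A Y = - B\<close>: on the copy of \<open>v\<close> a
    constant vector, which \<open>(x - 1) I - L(H)\<close> multiplies by \<open>x - 1\<close>, and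
    on the edges the incidence column divided by \<open>- (x - 2)\<close>.\<close>
  define y :: "('a + 'a set) + 'a \<times> 'b \<Rightarrow> ('a + 'a set) + 'a \<times> 'b \<Rightarrow> real" where
    "y c b = (case c of Inr (v, w) \<Rightarrow> if b = vert v then - 1 / (x - 1) else 0
      | Inl (Inr e) \<Rightarrow> if b \<in> vert ` e then - 1 / (x - 2) else 0
      | Inl (Inl v) \<Rightarrow> 0)" for c b
  have y_cv: "y (copy v w) (vert u) = (if v = u then - 1 / (x - 1) else 0)" for v w u
    by (auto simp: y_def defs)
  have y_ev: "y (edge e) (vert u) = (if u \<in> e then - 1 / (x - 2) else 0)" for e u
    by (auto simp: y_def defs)

  have elim_copy: "(\<Sum>c\<in>set (cs @ ?es). ?f (copy v w) c * y c (vert u)) = - ?f (copy v w) (vert u)"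
    if v: "v \<in> pverts G" and w: "w \<in> pverts H" and u: "u \<in> pverts G" for v w u
  proof -
    have "(\<Sum>c\<in>set (cs @ ?es). ?f (copy v w) c * y c (vert u))
        = (\<Sum>v'\<in>pverts G. if v' = v then
            (\<Sum>w'\<in>pverts H. laplacian_char (x - 1) H w w') * y (copy v w) (vert u) else 0)"
      unfolding sum_ce f_ce mult_zero_left sum.neutral_const add_0_right
      by (intro sum.cong refl) (auto simp: f_cc[OF v w] y_cv sum_distrib_right)
    \<comment> \<open>Here the row sum of \<open>(x - 1) I - L(H)\<close> enters; it cancels the
      denominator in \<open>y\<close>.\<close>
    also have "\<dots> = (x - 1) * y (copy v w) (vert u)"
      using v fin by (simp add: sum_laplacian_char[OF H w])
    also have "\<dots> = - ?f (copy v w) (vert u)"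
      using x by (simp add: f_cv[OF u w] y_cv)
    finally show ?thesis .
  qed
  have elim_edge: "(\<Sum>c\<in>set (cs @ ?es). ?f (edge e) c * y c (vert u)) = - ?f (edge e) (vert u)"
    if e: "e \<in> uedges G" for e u
  proof -
    have "(\<Sum>c\<in>set (cs @ ?es). ?f (edge e) c * y c (vert u))
        = (\<Sum>e'\<in>uedges G. if e' = e then (x - 2) * y (edge e) (vert u) else 0)"
      unfolding sum_ce using e by (auto simp: f_ee f_ce intro!: sum.cong)
    also have "\<dots> = - ?f (edge e) (vert u)"
      using x e fin by (simp add: f_ev y_ev)
    finally show ?thesis .
  qed
  \<comment> \<open>The copies change only the diagonal, by \<open>- n' / (x - 1)\<close>, since a
    copy meets a single vertex of \<open>G\<close>; the edges contribute
    \<open>- R R\<^sup>T / (x - 2)\<close>.\<close>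
  have schur: "?f (vert u) (vert u') + (\<Sum>c\<in>set (cs @ ?es). ?f (vert u) c * y c (vert u'))
      = - 1 / (x - 2) * laplacian_char z G u u'"
    if u: "u \<in> pverts G" and u': "u' \<in> pverts G" for u u'
  proof -
    have "(\<Sum>v\<in>pverts G. \<Sum>w\<in>pverts H. ?f (vert u) (copy v w) * y (copy v w) (vert u'))
        = (\<Sum>v\<in>pverts G. if v = u then n' * (if u = u' then - 1 / (x - 1) else 0) else 0)"
      using u by (intro sum.cong) (auto simp: f_cv y_cv n'_def)
    also have "\<dots> = (if u = u' then - n' / (x - 1) else 0)"
      using u fin by simp
    finally have copies: "(\<Sum>v\<in>pverts G. \<Sum>w\<in>pverts H. ?f (vert u) (copy v w) * y (copy v w) (vert u'))
        = (if u = u' then - n' / (x - 1) else 0)" .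
    have "(\<Sum>e\<in>uedges G. ?f (vert u) (edge e) * y (edge e) (vert u'))
        = (\<Sum>e\<in>uedges G. if u \<in> e \<and> u' \<in> e then - 1 / (x - 2) else 0)"
      by (intro sum.cong) (auto simp: f_ev y_ev)
    also have "\<dots> = card {e \<in> uedges G. u \<in> e \<and> u' \<in> e} * (- 1 / (x - 2))"
      using fin by (simp add: sum.If_cases Int_def)
    \<comment> \<open>Regularity makes the diagonal of \<open>R R\<^sup>T\<close> constant, so that
      the result is a multiple of \<open>z I - L(G)\<close> for one scalar \<open>z\<close>.\<close>
    also have "card {e \<in> uedges G. u \<in> e \<and> u' \<in> e}
        = (if u = u' then r else if (u, u') \<in> parcs G then 1 else 0)"
      using card_incident_uedges[OF G, of u] deg[OF u] card_common_uedges[OF G, of u u']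
      by (cases "u = u'") auto
    finally have edges: "(\<Sum>e\<in>uedges G. ?f (vert u) (edge e) * y (edge e) (vert u'))
        = (if u = u' then r else if (u, u') \<in> parcs G then 1 else 0) * (- 1 / (x - 2))"
      by simp
    have no_loop: "(u, u) \<notin> parcs G"
      by (auto dest: G.pair_no_loops)
    \<comment> \<open>Naming \<open>k\<close> hides the fraction with denominator
      \<open>x - 1\<close>, so that the identity below has the single denominator
      \<open>x - 2\<close>.\<close>
    define k where "k = x - r - n' - n' / (x - 1)"
    have z: "k - r / (x - 2) = - 1 / (x - 2) * (z - r)"
    proof -
      have "k - s / d = - 1 / d * (2 * s - d * k - s)" if "d \<noteq> 0" for s d :: real
        using that by (simp add: field_simps)
      moreover have "x - 2 \<noteq> 0"
        using x by simp
      moreover have "z = 2 * real r - (x - 2) * k"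
        by (simp only: z_def k_def)
      ultimately show ?thesis
        by (simp only:)
    qed
    show ?thesis
    proof (cases "u = u'")
      case True
      have "?f (vert u) (vert u') + (\<Sum>c\<in>set (cs @ ?es). ?f (vert u) c * y c (vert u')) = k - r / (x - 2)"
        unfolding sum_ce copies edges f_vv[OF u] k_def using True by simp
      also note z
      also have "z - r = laplacian_char z G u u'"
        using True no_loop deg[OF u] by (simp add: laplacian_char_def)
      finally show ?thesis .
    next
      case False
      then show ?thesis
        unfolding sum_ce copies edges f_vv[OF u] by (simp add: laplacian_char_def)
    qed
  qed

  have "poly (char_poly (laplacian_matrix vs ?C)) x = det_on ?f ((cs @ ?es) @ ?us)"
    unfolding poly_char_poly_laplacian[OF dist(3)] by (rule det_on_perm) fact
  also have "\<dots> = det_on ?f (cs @ ?es)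
      * det_on (\<lambda>a b. ?f a b + (\<Sum>c\<in>set (cs @ ?es). ?f a c * y c b)) ?us"
  proof (rule det_on_append_eliminate[OF dist_ce])
    fix a b assume "a \<in> set (cs @ ?es)" "b \<in> set ?us"
    then have "(\<exists>v\<in>pverts G. \<exists>w\<in>pverts H. a = copy v w) \<or> (\<exists>e\<in>uedges G. a = edge e)"
      and "b \<in> vert ` pverts G"
      by (auto simp: set_cs es sets)
    then show "(\<Sum>c\<in>set (cs @ ?es). ?f a c * y c b) = - ?f a b"
      by (elim disjE bexE imageE) (simp_all only: elim_copy elim_edge)
  qed
  also have "det_on (\<lambda>a b. ?f a b + (\<Sum>c\<in>set (cs @ ?es). ?f a c * y c b)) ?us
      = det_on (\<lambda>u u'. - 1 / (x - 2) * laplacian_char z G u u') us"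
    unfolding det_on_map by (rule det_on_cong) (use schur sets in blast)
  also have "\<dots> = (- 1 / (x - 2)) ^ n * poly (char_poly (laplacian_matrix us G)) z"
    unfolding det_on_smult poly_char_poly_laplacian[OF dist(1)] len ..
  also have "det_on ?f (cs @ ?es) = det_on ?f cs * det_on ?f ?es"
    by (rule det_on_append_block) (auto simp: set_cs f_ce)
  also have "det_on ?f cs = poly (char_poly (laplacian_matrix ws H)) (x - 1) ^ n"
    unfolding cs_def poly_char_poly_laplacian[OF dist(2)] len(1)[symmetric]
    by (rule det_on_copies[OF dist(1)]) (use f_cc sets in blast)
  also have "det_on ?f ?es = (x - 2) ^ m"
    unfolding det_on_map len_es[symmetric]
    by (rule det_on_diagonal[OF es(2)]) (use f_ee es in blast)
  finally show ?thesis .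
qed

section \<open>From values at real points to the identity in the fraction field\<close>

lemma to_fract_power: "to_fract (p ^ n) = to_fract p ^ n"
  by (induction n) simp_all


theorem theorem2p7:
  fixes G\<^sub>1 :: "'a pair_pre_digraph" and G\<^sub>2 :: "'b pair_pre_digraph"
    and r\<^sub>1 n\<^sub>1 m\<^sub>1 n\<^sub>2 :: nat
    and vs\<^sub>1 :: "'a list" and vs\<^sub>2 :: "'b list"
    and vs :: "(('a + 'a set) + 'a \<times> 'b) list"
    and \<mu>\<^sub>1 \<mu>\<^sub>2 :: "nat \<Rightarrow> real"
  assumes "regular_graph r\<^sub>1 G\<^sub>1"
    and "n\<^sub>1 = card (pverts G\<^sub>1)" and "m\<^sub>1 = card (uedges G\<^sub>1)"
    and "pair_graph G\<^sub>2" and "pverts G\<^sub>2 \<noteq> {}" and "n\<^sub>2 = card (pverts G\<^sub>2)"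
    and "enumerates vs\<^sub>1 (pverts G\<^sub>1)" and "enumerates vs\<^sub>2 (pverts G\<^sub>2)"
    and "enumerates vs (pverts (subdivision_vertex_corona G\<^sub>1 G\<^sub>2))"
    and "\<mu>\<^sub>1 = laplacian_eigenvalue vs\<^sub>1 G\<^sub>1" and "\<mu>\<^sub>2 = laplacian_eigenvalue vs\<^sub>2 G\<^sub>2"
  shows "to_fract (char_poly (laplacian_matrix vs (subdivision_vertex_corona G\<^sub>1 G\<^sub>2))) =
      to_fract [:-2, 1:] powi (int m\<^sub>1 - int n\<^sub>1)
      * to_fract (\<Prod>i = 2..n\<^sub>2. [:- 1 - \<mu>\<^sub>2 i, 1:] ^ n\<^sub>1)
      * to_fract (\<Prod>i = 1..n\<^sub>1.
          [:- \<mu>\<^sub>1 i,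
            2 + real r\<^sub>1 + \<mu>\<^sub>1 i + 2 * real n\<^sub>2,
            - (3 + real r\<^sub>1 + real n\<^sub>2),
            1:])"
proof -
  let ?C = "subdivision_vertex_corona G\<^sub>1 G\<^sub>2"
  let ?q = "[:-2, 1:] :: real poly"
  define P where "P = char_poly (laplacian_matrix vs ?C)"
  define Q where "Q = (\<Prod>i = 2..n\<^sub>2. [:- 1 - \<mu>\<^sub>2 i, 1:] ^ n\<^sub>1)"
  define R where "R = (\<Prod>i = 1..n\<^sub>1. [:- \<mu>\<^sub>1 i, 2 + real r\<^sub>1 + \<mu>\<^sub>1 i + 2 * real n\<^sub>2,
    - (3 + real r\<^sub>1 + real n\<^sub>2), 1:])"
  have G: "pair_graph G\<^sub>1"
    using assms(1) by (simp add: regular_graph_def)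
  have len: "length vs\<^sub>1 = n\<^sub>1" "length vs\<^sub>2 = n\<^sub>2"
    using assms(2,6-8) by (auto simp: enumerates_def dest: distinct_card)
  have "vs\<^sub>2 \<noteq> []"
    using assms(5,8) by (auto simp: enumerates_def)
  then have n2: "1 \<le> n\<^sub>2" and mu2: "\<mu>\<^sub>2 1 = 0"
    using len char_poly_laplacian(2)[OF assms(4,8)] assms(11) by (auto simp: Suc_le_eq)
  have cp1: "char_poly (laplacian_matrix vs\<^sub>1 G\<^sub>1) = (\<Prod>i = 1..n\<^sub>1. [:- \<mu>\<^sub>1 i, 1:])"
    using char_poly_laplacian(1)[OF G assms(7)] assms(10) len by simp
  have "char_poly (laplacian_matrix vs\<^sub>2 G\<^sub>2) = (\<Prod>i = 1..n\<^sub>2. [:- \<mu>\<^sub>2 i, 1:])"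
    using char_poly_laplacian(1)[OF assms(4,8)] assms(11) len by simp
  \<comment> \<open>The factor for the eigenvalue 0 is split off. Evaluated at \<open>x - 1\<close>
    it gives the power of \<open>x - 1\<close> that later clears the denominator in
    \<open>z\<close>.\<close>
  also have "\<dots> = [:- \<mu>\<^sub>2 1, 1:] * (\<Prod>i = Suc 1..n\<^sub>2. [:- \<mu>\<^sub>2 i, 1:])"
    using n2 by (rule prod.atLeast_Suc_atMost)
  finally have cp2: "char_poly (laplacian_matrix vs\<^sub>2 G\<^sub>2) = [:0, 1:] * (\<Prod>i = 2..n\<^sub>2. [:- \<mu>\<^sub>2 i, 1:])"
    unfolding mu2 by (simp only: minus_zero Suc_1)

  \<comment> \<open>The exponent in the claim may be negative, so the powers of \<open>?q\<close>
    are distributed to both sides and the equation stays among polynomials.\<close>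
  have eval: "poly (P * ?q ^ n\<^sub>1) x = poly (?q ^ m\<^sub>1 * Q * R) x" if x: "x \<noteq> 1" "x \<noteq> 2" for x
  proof -
    define z where "z = 2 * real r\<^sub>1 - (x - 2) * (x - real r\<^sub>1 - real n\<^sub>2 - real n\<^sub>2 / (x - 1))"
    \<comment> \<open>Writing \<open>n\<^sub>2\<close> as \<open>(x - 1) * k\<close> makes
      \<open>cubic\<close> a polynomial identity free of division.\<close>
    define k where "k = real n\<^sub>2 / (x - 1)"
    have n\<^sub>2: "real n\<^sub>2 = (x - 1) * k"
      using x by (simp add: k_def)
    have z: "z = 2 * real r\<^sub>1 - (x - 2) * (x - real r\<^sub>1 - real n\<^sub>2 - k)"
      by (simp only: z_def k_def)
    have cubic: "(x - 1) * (- 1 * (z - \<mu>)) = poly [:- \<mu>, 2 + real r\<^sub>1 + \<mu> + 2 * real n\<^sub>2,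
        - (3 + real r\<^sub>1 + real n\<^sub>2), 1:] x" for \<mu>
      unfolding z n\<^sub>2 by (simp add: algebra_simps)
    \<comment> \<open>Each of the \<open>n\<^sub>1\<close> linear factors
      \<open>z - \<mu>\<^sub>1 i\<close> receives one \<open>x - 1\<close> and one sign, the sign
      stemming from the scalar \<open>- 1 / (x - 2)\<close> of the Schur complement.\<close>
    have R: "(x - 1) ^ n\<^sub>1 * ((- 1) ^ n\<^sub>1 * poly (char_poly (laplacian_matrix vs\<^sub>1 G\<^sub>1)) z) = poly R x"
    proof -
      have "(x - 1) ^ n\<^sub>1 * ((- 1) ^ n\<^sub>1 * poly (char_poly (laplacian_matrix vs\<^sub>1 G\<^sub>1)) z)
          = (\<Prod>i = 1..n\<^sub>1. (x - 1) * (- 1 * (z - \<mu>\<^sub>1 i)))"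
        unfolding cp1 prod.distrib by (simp add: poly_prod)
      then show ?thesis
        unfolding cubic R_def poly_prod .
    qed
    have shift: "poly [:- 1 - a, 1:] x = poly [:- a, 1:] (x - 1)" for a
      by simp
    have Q: "poly (char_poly (laplacian_matrix vs\<^sub>2 G\<^sub>2)) (x - 1) ^ n\<^sub>1 = (x - 1) ^ n\<^sub>1 * poly Q x"
      unfolding cp2 Q_def poly_mult poly_prod power_mult_distrib poly_power prod_power_distrib shift
      by simp
    have "poly P x = ((x - 1) ^ n\<^sub>1 * poly Q x) * (x - 2) ^ m\<^sub>1
        * ((- 1 / (x - 2)) ^ n\<^sub>1 * poly (char_poly (laplacian_matrix vs\<^sub>1 G\<^sub>1)) z)"
      using poly_char_poly_corona[OF assms(1,4,7-9) x]
      unfolding P_def z_def Q[symmetric] assms(2,3,6)[symmetric] .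
    moreover have "(- 1 / (x - 2)) ^ n\<^sub>1 * (x - 2) ^ n\<^sub>1 = (- 1) ^ n\<^sub>1"
      using x by (simp add: power_mult_distrib[symmetric])
    ultimately have "poly P x * (x - 2) ^ n\<^sub>1 = (x - 2) ^ m\<^sub>1 * poly Q x
        * ((x - 1) ^ n\<^sub>1 * ((- 1) ^ n\<^sub>1 * poly (char_poly (laplacian_matrix vs\<^sub>1 G\<^sub>1)) z))"
      by (simp only: mult_ac)
    then show ?thesis
      unfolding R by simp
  qed
  \<comment> \<open>The extra factors vanish at the excluded points 1 and 2, so the product is zero
    at every real number and hence as a polynomial; they are then cancelled in the integral
    domain.\<close>
  have "poly ((P * ?q ^ n\<^sub>1 - ?q ^ m\<^sub>1 * Q * R) * ([:-1, 1:] * ?q)) x = 0" for x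
    using eval[of x] by (cases "x = 1 \<or> x = 2") auto
  then have "(P * ?q ^ n\<^sub>1 - ?q ^ m\<^sub>1 * Q * R) * ([:-1, 1:] * ?q) = 0"
    using poly_all_0_iff_0 by blast
  then have "P * ?q ^ n\<^sub>1 = ?q ^ m\<^sub>1 * Q * R"
    by (simp only: mult_eq_0_iff right_minus_eq) simp
  \<comment> \<open>In the fraction field \<open>?q\<close> is invertible, and the integer power in
    the claim makes sense.\<close>
  then have "to_fract P * to_fract ?q ^ n\<^sub>1 = to_fract ?q ^ m\<^sub>1 * to_fract Q * to_fract R"
    by (simp only: to_fract_mult[symmetric] to_fract_power[symmetric])
  moreover have "to_fract ?q \<noteq> 0"
    by simp
  ultimately have "to_fract P = to_fract ?q powi (int m\<^sub>1 - int n\<^sub>1) * to_fract Q * to_fract R"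
    by (simp add: power_int_diff field_simps)
  then show ?thesis
    unfolding P_def Q_def R_def .
qed

end
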